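(* Let $\mathcal{A}$ be a deterministic finite automaton with set of states $\{1,\ldots,n\}$, initial state $1$ and set of final states $\emptyset\neq F\subseteq\{1,\ldots,n\}$, recognizing a regular language $\mathcal{L}$. Assume that the adjacency matrix $A=(a_{ij})$ of the underlying graph of $\mathcal{A}$ is primitive. Let $\lambda$ denote the dominant eigenvalue of $A$, and assume that all other eigenvalues of $A$ have modulus less than or equal to $\xi\lambda$ for some $0<\xi<1$. If there are eigenvalues of modulus $\xi\lambda$, assume that each of them is semisimple, i.e., its algebraic and geometric multiplicities coincide. Let $w>0$ and $u>0$ be (entrywise positive) right and left eigenvectors of $A$ for the eigenvalue $\lambda$, respectively, such that $w_1=1$ and $\langle u,w\rangle=1$. For a transition $t$ from state $i$ to state $j$, set $$p_t=\frac{w_j}{w_i\lambda}.$$ For $\ell\ge 0$, let $\mathcal{L}_\ell$ be the set of words of $\mathcal{L}$ of length $\ell$. For $x\in\mathcal{L}_\ell$, let $1=s_0,\ldots,s_\ell$ and $t_1,\ldots,t_\ell$ be the states and transitions used when $\mathcal{A}$ reads $x$, and define the weight $$W_\ell(x)=\frac{1}{w_{s_\ell}\langle u,e_F\rangle}\prod_{j=1}^{\ell}p_{t_j},$$ where $e_F$ is the indicator vector of $F$. Then $$\sum_{t\text{ leaves }i}p_t=1$$ holds for all states $i$, and $$W_\ell(x)=\frac{1}{|\mathcal{L}_\ell|}\bigl(1+O(\xi^\ell)\bigr)$$ holds uniformly for $\ell\ge 0$ and $x\in\mathcal{L}_\ell$. Furthermore, consider the time-homogeneous Markov chain $\mathcal{M}$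 on the state space $\{1,\ldots,n\}$ where the transition probability from state $i$ to state $j$ is $\sum_t p_t$, the sum running over all transitions $t$ of $\mathcal{A}$ from $i$ to $j$. Then this Markov chain has the stationary distribution $(u_1w_1,\ldots,u_nw_n)$.
   Context: An automaton consists of finitely many states, labelled transitions between states, an initial state and final states; it recognizes a word if there is a path starting at the initial state and leading to a final state whose sequence of labels is the word. Deterministic means that for each state and each letter there is at most one transition leaving the state with that letter as label. The underlying graph is the directed multigraph of the transitions; the entry $a_{ij}$ of its adjacency matrix is the number of transitions from $i$ to $j$. Multiple transitions between the same two states are counted separately in sums over transitions. *)

theory Defs
  imports
    Complex_Main
    "Jordan_Normal_Form.Matrix"
    "Jordan_Normal_Form.Char_Poly"
    "Jordan_Normal_Form.Matrix_Kernel"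
begin

text \<open>
  Transitions are triples and a finite automaton has a finite set of them, so transitions with the
  same end points but different labels are distinct. No separate alphabet is recorded: letters
  labelling no transition do not occur in recognized words.

  Since vectors and matrices are indexed from 0, the states of an automaton with \<open>n\<close> states are
  \<open>0, ..., n - 1\<close> instead of \<open>1, ..., n\<close>.
\<close>

datatype 'a transition = Transition (source: nat) (letter: 'a) (target: nat)

record 'a automaton =
  num_states :: nat
  transitions :: "'a transition set"
  initial :: nat
  finals :: "nat set"

definition finite_automaton :: "'a automaton \<Rightarrow> bool" where
  "finite_automaton M \<longleftrightarrow>
     finite (transitions M) \<and>
     (\<forall>t\<in>transitions M. source t < num_states M \<and> target t < num_states M) \<and>
     initial M < num_states M \<and>
     finals M \<subseteq> {..<num_states M}"

definition deterministic :: "'a automaton \<Rightarrow> bool" where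
  "deterministic M \<longleftrightarrow>
     (\<forall>t\<in>transitions M. \<forall>t'\<in>transitions M.
        source t = source t' \<and> letter t = letter t' \<longrightarrow> t = t')"

fun path :: "'a automaton \<Rightarrow> nat \<Rightarrow> 'a transition list \<Rightarrow> bool" where
  "path M i [] \<longleftrightarrow> True"
| "path M i (t # ts) \<longleftrightarrow> t \<in> transitions M \<and> source t = i \<and> path M (target t) ts"

definition end_state :: "nat \<Rightarrow> 'a transition list \<Rightarrow> nat" where
  "end_state i ts = last (i # map target ts)"

definition language :: "'a automaton \<Rightarrow> 'a list set" where
  "language M =
     {x. \<exists>ts. path M (initial M) ts \<and> map letter ts = x \<and> end_state (initial M) ts \<in> finals M}"

definition language_of_length :: "'a automaton \<Rightarrow> nat \<Rightarrow> 'a list set" where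
  "language_of_length M l = {x \<in> language M. length x = l}"

text \<open>
  The transitions used when reading a word. For a deterministic automaton there is at most one path
  with a given label sequence, and there is one if the word is recognized.
\<close>

definition run :: "'a automaton \<Rightarrow> 'a list \<Rightarrow> 'a transition list" where
  "run M x = (THE ts. path M (initial M) ts \<and> map letter ts = x)"

definition adjacency_mat :: "'a automaton \<Rightarrow> real mat" where
  "adjacency_mat M = mat (num_states M) (num_states M)
     (\<lambda>(i, j). real (card {t \<in> transitions M. source t = i \<and> target t = j}))"

definition primitive_mat :: "real mat \<Rightarrow> bool" where
  "primitive_mat A \<longleftrightarrow>
     square_mat A \<and>
     (\<forall>i<dim_row A. \<forall>j<dim_row A. 0 \<le> A $$ (i, j)) \<and>
     (\<exists>k>0. \<forall>i<dim_row A. \<forall>j<dim_row A. 0 < (A ^\<^sub>m k) $$ (i, j))"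

definition dominant_eigenvalue :: "complex mat \<Rightarrow> complex \<Rightarrow> bool" where
  "dominant_eigenvalue A \<mu> \<longleftrightarrow>
     eigenvalue A \<mu> \<and> (\<forall>\<nu>. eigenvalue A \<nu> \<and> \<nu> \<noteq> \<mu> \<longrightarrow> cmod \<nu> < cmod \<mu>)"

definition algebraic_multiplicity :: "'a :: field mat \<Rightarrow> 'a \<Rightarrow> nat" where
  "algebraic_multiplicity A \<mu> = Polynomial.order \<mu> (char_poly A)"

definition geometric_multiplicity :: "'a :: field mat \<Rightarrow> 'a \<Rightarrow> nat" where
  "geometric_multiplicity A \<mu> = kernel_dim (char_matrix A \<mu>)"

definition semisimple_eigenvalue :: "'a :: field mat \<Rightarrow> 'a \<Rightarrow> bool" where
  "semisimple_eigenvalue A \<mu> \<longleftrightarrow>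
     eigenvalue A \<mu> \<and> algebraic_multiplicity A \<mu> = geometric_multiplicity A \<mu>"

definition positive_vec :: "real vec \<Rightarrow> bool" where
  "positive_vec v \<longleftrightarrow> (\<forall>i<dim_vec v. 0 < v $ i)"

text \<open>Left eigenvectors are represented as column vectors.\<close>

definition left_eigenvector :: "'a :: comm_ring_1 mat \<Rightarrow> 'a vec \<Rightarrow> 'a \<Rightarrow> bool" where
  "left_eigenvector A v \<mu> \<longleftrightarrow> eigenvector (transpose_mat A) v \<mu>"

definition indicator_vec :: "nat \<Rightarrow> nat set \<Rightarrow> real vec" where
  "indicator_vec n S = vec n (\<lambda>i. if i \<in> S then 1 else 0)"

definition transition_weight :: "real \<Rightarrow> real vec \<Rightarrow> 'a transition \<Rightarrow> real" where
  "transition_weight lam w t = w $ target t / (w $ source t * lam)"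

definition word_weight ::
    "'a automaton \<Rightarrow> real \<Rightarrow> real vec \<Rightarrow> real vec \<Rightarrow> 'a list \<Rightarrow> real" where
  "word_weight M lam w u x =
     1 / (w $ end_state (initial M) (run M x) * (u \<bullet> indicator_vec (num_states M) (finals M))) *
     (\<Prod>t\<leftarrow>run M x. transition_weight lam w t)"

text \<open>
  A time-homogeneous Markov chain on a finite state space is given by its matrix of transition
  probabilities.
\<close>

definition chain_mat :: "'a automaton \<Rightarrow> real \<Rightarrow> real vec \<Rightarrow> real mat" where
  "chain_mat M lam w = mat (num_states M) (num_states M)
     (\<lambda>(i, j). \<Sum>t | t \<in> transitions M \<and> source t = i \<and> target t = j. transition_weight lam w t)"

definition distribution_vec :: "real vec \<Rightarrow> bool" where
  "distribution_vec v \<longleftrightarrow> (\<forall>i<dim_vec v. 0 \<le> v $ i) \<and> (\<Sum>i<dim_vec v. v $ i) = 1"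

definition stochastic_mat :: "real mat \<Rightarrow> bool" where
  "stochastic_mat P \<longleftrightarrow> square_mat P \<and> (\<forall>i<dim_row P. distribution_vec (row P i))"

definition stationary_distribution :: "real mat \<Rightarrow> real vec \<Rightarrow> bool" where
  "stationary_distribution P v \<longleftrightarrow>
     v \<in> carrier_vec (dim_row P) \<and> distribution_vec v \<and> transpose_mat P *\<^sub>v v = v"

end

theory Submission
  imports
    Defs
    "Jordan_Normal_Form.Jordan_Normal_Form_Existence"
    "Jordan_Normal_Form.Jordan_Normal_Form_Uniqueness"
begin

text \<open>
  The weights telescope along a path: for \<open>x\<close> in the language, of length \<open>l\<close>, the weight is
  \<open>1 / (lam\<^sup>l \<langle>u, e\<rangle>)\<close> with \<open>e\<close> the indicator vector of the final states, while the number of words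
  of length \<open>l\<close> is the initial entry of \<open>A\<^sup>l e\<close>. Splitting \<open>e = \<langle>u, e\<rangle> w + v\<close> with \<open>\<langle>u, v\<rangle> = 0\<close>, the
  first summand contributes \<open>lam\<^sup>l \<langle>u, e\<rangle>\<close>. The eigenvalues of \<open>A - lam w u\<^sup>T\<close>, which acts like \<open>A\<close>
  on \<open>v\<close>, have modulus at most \<open>\<xi> lam\<close>, because \<open>lam\<close> is geometrically simple by positivity of a
  power of \<open>A\<close>; those of modulus \<open>\<xi> lam\<close> have Jordan blocks of size one only, so \<open>A\<^sup>l v\<close> is of
  order \<open>(\<xi> lam)\<^sup>l\<close>. If \<open>p\<close> is stationary, then the vector of the \<open>p\<^sub>i / w\<^sub>i\<close> is a left eigenvector of
  \<open>A\<close>, so uniqueness is geometric simplicity for the transposed matrix.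
\<close>

section \<open>Powers of matrices\<close>

lemma index_mult_mat_vec_sum:
  assumes "A \<in> carrier_mat nr nc" "v \<in> carrier_vec nc" "i < nr"
  shows "(A *\<^sub>v v) $ i = (\<Sum>j<nc. A $$ (i, j) * v $ j)"
  using assms by (simp add: scalar_prod_def atLeast0LessThan)

lemma scalar_prod_sum:
  assumes "v \<in> carrier_vec n"
  shows "u \<bullet> v = (\<Sum>j<n. u $ j * v $ j)"
  using assms by (simp add: scalar_prod_def atLeast0LessThan)

lemma smult_mat_pow:
  fixes A :: "'a :: comm_ring_1 mat"
  assumes A: "A \<in> carrier_mat n n"
  shows "(c \<cdot>\<^sub>m A) ^\<^sub>m k = c ^ k \<cdot>\<^sub>m (A ^\<^sub>m k)"
proof (induction k)
  case 0
  then show ?case using A by auto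
next
  case (Suc k)
  have "(c \<cdot>\<^sub>m A) ^\<^sub>m Suc k = (c ^ k \<cdot>\<^sub>m (A ^\<^sub>m k)) * (c \<cdot>\<^sub>m A)"
    using Suc by simp
  also have "\<dots> = c ^ Suc k \<cdot>\<^sub>m (A ^\<^sub>m k * A)"
    using A by (intro eq_matI) (auto simp: ac_simps)
  finally show ?case by simp
qed

lemma pow_mat_mult_vec_Suc:
  fixes A :: "'a :: comm_semiring_1 mat"
  assumes "A \<in> carrier_mat n n" "v \<in> carrier_vec n"
  shows "A ^\<^sub>m Suc k *\<^sub>v v = A ^\<^sub>m k *\<^sub>v (A *\<^sub>v v)"
  using assms by (simp add: assoc_mult_mat_vec[of _ n n _ n])

lemma pow_mat_Suc_left:
  fixes A :: "'a :: semiring_1 mat"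
  assumes "A \<in> carrier_mat n n"
  shows "A ^\<^sub>m Suc k = A * A ^\<^sub>m k"
proof (induction k)
  case 0
  then show ?case using assms by simp
next
  case (Suc k)
  have "A ^\<^sub>m Suc (Suc k) = (A * A ^\<^sub>m k) * A" using Suc by simp
  also have "\<dots> = A * (A ^\<^sub>m k * A)" using assms by (intro assoc_mult_mat) auto
  finally show ?case by simp
qed

lemma pow_mat_mult_vec_Suc_left:
  fixes A :: "'a :: comm_semiring_1 mat"
  assumes "A \<in> carrier_mat n n" "v \<in> carrier_vec n"
  shows "A ^\<^sub>m Suc k *\<^sub>v v = A *\<^sub>v (A ^\<^sub>m k *\<^sub>v v)"
  using assms unfolding pow_mat_Suc_left[OF assms(1)]
  by (simp add: assoc_mult_mat_vec[of _ n n _ n])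

lemma transpose_pow_mat:
  fixes A :: "'a :: comm_semiring_1 mat"
  assumes "A \<in> carrier_mat n n"
  shows "transpose_mat A ^\<^sub>m k = transpose_mat (A ^\<^sub>m k)"
proof (induction k)
  case 0
  then show ?case using assms by simp
next
  case (Suc k)
  then show ?case using assms pow_mat_Suc_left[OF assms, of k]
    by (simp add: transpose_mult[of _ n n _ n])
qed

lemma pow_mat_mult_eigenvector:
  fixes A :: "'a :: field mat"
  assumes "A \<in> carrier_mat n n" "v \<in> carrier_vec n" "A *\<^sub>v v = c \<cdot>\<^sub>v v"
  shows "A ^\<^sub>m k *\<^sub>v v = c ^ k \<cdot>\<^sub>v v"
proof (induction k)
  case 0
  then show ?case using assms by simp
next
  case (Suc k)
  have "A ^\<^sub>m Suc k *\<^sub>v v = A *\<^sub>v (c ^ k \<cdot>\<^sub>v v)"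
    unfolding pow_mat_mult_vec_Suc_left[OF assms(1,2)] Suc ..
  also have "\<dots> = c ^ k \<cdot>\<^sub>v (c \<cdot>\<^sub>v v)"
    using assms by (simp add: mult_mat_vec)
  finally show ?case by (simp add: smult_smult_assoc ac_simps)
qed

text \<open>The assumption on \<open>u\<close> is the left eigenvector equation in functional form.
  It is met by the characteristic matrices of \<open>A\<close> and of the deflated matrix, with
  factors \<open>lam - \<mu>\<close> and \<open>- \<mu>\<close>.\<close>

lemma scalar_prod_pow_mat_mult_vec:
  fixes C :: "'a :: comm_ring_1 mat"
  assumes C: "C \<in> carrier_mat n n"
    and "\<And>v. v \<in> carrier_vec n \<Longrightarrow> u \<bullet> (C *\<^sub>v v) = c * (u \<bullet> v)"
    and "v \<in> carrier_vec n"
  shows "u \<bullet> (C ^\<^sub>m k *\<^sub>v v) = c ^ k * (u \<bullet> v)"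
  using assms(3)
proof (induction k arbitrary: v)
  case 0
  then show ?case using C by simp
next
  case (Suc k)
  have "u \<bullet> (C ^\<^sub>m Suc k *\<^sub>v v) = u \<bullet> (C ^\<^sub>m k *\<^sub>v (C *\<^sub>v v))"
    using C Suc.prems by (simp only: pow_mat_mult_vec_Suc)
  also have "\<dots> = c ^ k * (u \<bullet> (C *\<^sub>v v))"
    using C Suc.prems by (intro Suc.IH) auto
  finally show ?case using Suc.prems assms(2) by (simp add: ac_simps)
qed

lemma char_matrix_mult_vec:
  assumes "A \<in> carrier_mat n n" "v \<in> carrier_vec n"
  shows "char_matrix A \<mu> *\<^sub>v v = A *\<^sub>v v - \<mu> \<cdot>\<^sub>v v"
  using assms unfolding char_matrix_def
  by (intro eq_vecI) (auto simp: add_scalar_prod_distrib[of _ n])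

section \<open>Growth of powers and Jordan blocks\<close>

lemma jordan_nf_dim:
  assumes "jordan_nf A n_as"
  shows "dim_row A = sum_list (map fst n_as)"
proof -
  have "similar_mat A (jordan_matrix n_as)"
    using assms by (simp add: jordan_nf_def)
  from similar_matD[OF this] obtain n where
    "A \<in> carrier_mat n n" "jordan_matrix n_as \<in> carrier_mat n n" by auto
  then show ?thesis
    using jordan_matrix_dim(1)[of n_as] by (metis carrier_matD(1))
qed

text \<open>The order of the root is the total size of the Jordan blocks for \<open>\<mu>\<close>;
  the generalized eigenspace counts each block truncated at the exponent. No block exceeds the
  dimension, so nothing is cut off. Algebraic multiplicities can thus be compared through
  kernels.\<close>

lemma algebraic_multiplicity_eq_dim_gen_eigenspace:
  assumes "jordan_nf A n_as"
  shows "algebraic_multiplicity A \<mu> = dim_gen_eigenspace A \<mu> (dim_row A)"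
proof -
  have "[(n, e)\<leftarrow>n_as . e = \<mu>] = filter (\<lambda>na. snd na = \<mu>) n_as"
    by (simp add: case_prod_beta')
  moreover have "map (min (dim_row A)) (map fst (filter (\<lambda>na. snd na = \<mu>) n_as)) =
      map fst (filter (\<lambda>na. snd na = \<mu>) n_as)"
    unfolding jordan_nf_dim[OF assms]
    by (rule map_idI) (force intro!: min_absorb2 member_le_sum_list)
  ultimately show ?thesis
    unfolding algebraic_multiplicity_def dim_gen_eigenspace[OF assms] jordan_nf_order[OF assms]
    by (simp only:)
qed

lemma geometric_multiplicity_eq_dim_gen_eigenspace:
  assumes "A \<in> carrier_mat n n"
  shows "geometric_multiplicity A \<mu> = dim_gen_eigenspace A \<mu> 1"
  unfolding geometric_multiplicity_def dim_gen_eigenspace_def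
  using char_matrix_closed[OF assms, of \<mu>] by (simp add: left_mult_one_mat[of _ n n])

lemma complex_jordan_nf_exists:
  fixes A :: "complex mat"
  assumes "A \<in> carrier_mat n n"
  obtains n_as where "jordan_nf A n_as"
  using char_poly_factorized[OF assms] jordan_nf_exists[OF assms] by blast

text \<open>Truncation never increases a term, so equal sums force equality term by term.\<close>

lemma sum_list_min_1_eq_imp_le_1:
  fixes ns :: "nat list"
  assumes "sum_list ns = sum_list (map (min 1) ns)" "n \<in> set ns"
  shows "n \<le> 1"
proof -
  have *: "sum_list (map (min 1) ns) \<le> sum_list ns" for ns :: "nat list"
    by (induction ns) auto
  from assms show ?thesis
  proof (induction ns)
    case (Cons m ns)
    have "sum_list ns = sum_list (map (min 1) ns)" "m \<le> 1"
      using Cons.prems(1) *[of ns] by auto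
    with Cons show ?case by auto
  qed simp
qed

text \<open>The algebraic multiplicity adds up the block sizes for \<open>\<mu>\<close>, the
  geometric one counts each block once; equality leaves no room for a larger block.\<close>

lemma semisimple_jordan_block_le_1:
  assumes "A \<in> carrier_mat n n" "jordan_nf A n_as" "semisimple_eigenvalue A \<mu>" "(m, \<mu>) \<in> set n_as"
  shows "m \<le> 1"
proof (rule sum_list_min_1_eq_imp_le_1)
  let ?ns = "map fst [(n, e)\<leftarrow>n_as . e = \<mu>]"
  show "m \<in> set ?ns" using assms(4) by force
  show "sum_list ?ns = sum_list (map (min 1) ?ns)"
    using assms(3) unfolding semisimple_eigenvalue_def
      geometric_multiplicity_eq_dim_gen_eigenspace[OF assms(1)] dim_gen_eigenspace[OF assms(2)]
      algebraic_multiplicity_def jordan_nf_order[OF assms(2)]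
    by (simp add: case_prod_beta')
qed

lemma jordan_nf_eigenvalue:
  fixes A :: "'a :: field mat"
  assumes A: "A \<in> carrier_mat n n" and jnf: "jordan_nf A n_as" and mem: "(m, \<mu>) \<in> set n_as"
  shows "eigenvalue A \<mu>"
proof -
  have "m > 0" using jnf mem unfolding jordan_nf_def by force
  moreover have "m \<le> Polynomial.order \<mu> (char_poly A)"
    using jordan_nf_block_size_order_bound[OF jnf mem] .
  ultimately have "Polynomial.order \<mu> (char_poly A) \<noteq> 0" by simp
  then have "poly (char_poly A) \<mu> = 0" by (meson order_root)
  then show ?thesis by (simp add: eigenvalue_root_char_poly[OF A])
qed

text \<open>Dividing by \<open>r\<close> moves the spectrum into the closed unit disc, and
  semisimplicity leaves only blocks of size one on the unit circle. Powers of such a matrix stay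
  bounded; scaling back contributes \<open>r ^ k\<close>.\<close>

lemma pow_mat_bound_semisimple:
  fixes A :: "complex mat"
  assumes A: "A \<in> carrier_mat n n" and r: "r > 0"
    and le: "\<And>\<mu>. eigenvalue A \<mu> \<Longrightarrow> cmod \<mu> \<le> r"
    and eq: "\<And>\<mu>. eigenvalue A \<mu> \<Longrightarrow> cmod \<mu> = r \<Longrightarrow> semisimple_eigenvalue A \<mu>"
  shows "\<exists>c. \<forall>k. norm_bound (A ^\<^sub>m k) (c * r ^ k)"
proof -
  obtain n_as where jnf: "jordan_nf A n_as" using complex_jordan_nf_exists[OF A] .
  let ?s = "complex_of_real (1 / r)"
  have s: "?s \<noteq> 0" "cmod ?s = 1 / r" using r by (auto simp: norm_divide)
  let ?A = "?s \<cdot>\<^sub>m A"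
  let ?as = "map (\<lambda>(m, a). (m, ?s * a)) n_as"
  have jnf': "jordan_nf ?A ?as" by (rule jordan_nf_smult[OF jnf s(1)])
  \<comment> \<open>The exponent \<open>1 - 1\<close> is the bound on the block sizes on the unit
    circle minus one, so the polynomial bound is a constant.\<close>
  have "\<exists>c1 c2. \<forall>k. norm_bound (?A ^\<^sub>m k) (c1 + c2 * of_nat k ^ (1 - 1))"
  proof (rule jordan_nf_matrix_poly_bound[OF _ _ _ jnf', of n])
    show "?A \<in> carrier_mat n n" using A by simp
  next
    fix m a assume "(m, a) \<in> set ?as"
    then obtain b where b: "(m, b) \<in> set n_as" "a = ?s * b" by auto
    show "cmod a \<le> 1"
      using le[OF jordan_nf_eigenvalue[OF A jnf b(1)]] r by (simp add: b(2) norm_mult norm_divide)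
    assume "cmod a = 1"
    then have "cmod b = r" using r by (simp add: b(2) norm_mult norm_divide)
    then show "m \<le> 1"
      using semisimple_jordan_block_le_1[OF A jnf _ b(1)] eq jordan_nf_eigenvalue[OF A jnf b(1)]
      by blast
  qed
  then obtain c where c: "\<And>k. norm_bound (?A ^\<^sub>m k) c" by auto
  show ?thesis
  proof (intro exI[of _ c] allI norm_boundI)
    fix k i j assume ij: "i < dim_row (A ^\<^sub>m k)" "j < dim_col (A ^\<^sub>m k)"
    then have "i < dim_row (?A ^\<^sub>m k)" "j < dim_col (?A ^\<^sub>m k)"
      unfolding smult_mat_pow[OF A] by auto
    then have "cmod ((?A ^\<^sub>m k) $$ (i, j)) \<le> c"
      using c[of k] unfolding norm_bound_def by blast
    moreover have "(A ^\<^sub>m k) $$ (i, j) = complex_of_real r ^ k * (?A ^\<^sub>m k) $$ (i, j)"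
      unfolding smult_mat_pow[OF A] using ij r by (simp add: power_divide)
    ultimately show "cmod ((A ^\<^sub>m k) $$ (i, j)) \<le> c * r ^ k"
      using r by (simp add: norm_mult norm_power mult.commute[of c])
  qed
qed

section \<open>Deflation\<close>

text \<open>Off \<open>0\<close> and \<open>lam\<close>, all generalized eigenvectors of \<open>A\<close> and of the deflated matrix
  \<open>A - lam w u\<^sup>T\<close> are annihilated by \<open>u\<close>, and on the annihilator of \<open>u\<close> the two matrices agree.
  Comparing kernels transfers semisimplicity.\<close>

locale deflation =
  fixes A :: "'a :: field mat" and n :: nat and lam :: 'a and w u :: "'a vec"
  assumes A: "A \<in> carrier_mat n n"
    and w: "w \<in> carrier_vec n"
    and u: "u \<in> carrier_vec n"
    and left: "transpose_mat A *\<^sub>v u = lam \<cdot>\<^sub>v u"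
    and uw: "u \<bullet> w = 1"
begin

definition deflated :: "'a mat" where
  "deflated = mat n n (\<lambda>(i, j). A $$ (i, j) - lam * w $ i * u $ j)"

lemma deflated_carrier: "deflated \<in> carrier_mat n n"
  by (simp add: deflated_def)

lemma scalar_prod_mult_mat:
  assumes "v \<in> carrier_vec n"
  shows "u \<bullet> (A *\<^sub>v v) = lam * (u \<bullet> v)"
  using transpose_vec_mult_scalar[OF A assms u] left assms u by simp

lemma deflated_mult_vec:
  assumes "v \<in> carrier_vec n"
  shows "deflated *\<^sub>v v = A *\<^sub>v v - (lam * (u \<bullet> v)) \<cdot>\<^sub>v w"
proof (rule eq_vecI)
  fix i assume "i < dim_vec (A *\<^sub>v v - (lam * (u \<bullet> v)) \<cdot>\<^sub>v w)"
  then have i: "i < n" using w by simp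
  have "(deflated *\<^sub>v v) $ i = (\<Sum>j<n. (A $$ (i, j) - lam * w $ i * u $ j) * v $ j)"
    unfolding index_mult_mat_vec_sum[OF deflated_carrier assms i] using i by (simp add: deflated_def)
  also have "\<dots> = (\<Sum>j<n. A $$ (i, j) * v $ j) - lam * w $ i * (\<Sum>j<n. u $ j * v $ j)"
    by (simp add: algebra_simps sum_subtractf sum_distrib_left)
  also have "\<dots> = (A *\<^sub>v v - (lam * (u \<bullet> v)) \<cdot>\<^sub>v w) $ i"
    using assms i w A index_mult_mat_vec_sum[OF A assms i] by (simp add: scalar_prod_sum[OF assms])
  finally show "(deflated *\<^sub>v v) $ i = (A *\<^sub>v v - (lam * (u \<bullet> v)) \<cdot>\<^sub>v w) $ i" .
qed (use w in \<open>simp add: deflated_def\<close>)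

text \<open>Pairing with \<open>u\<close> gives \<open>lam * (u \<bullet> v)\<close> for
  \<open>A\<close> and, because \<open>u \<bullet> w = 1\<close>, the same value for the subtracted
  rank-one term.\<close>

lemma scalar_prod_deflated:
  assumes "v \<in> carrier_vec n"
  shows "u \<bullet> (deflated *\<^sub>v v) = 0"
  using assms A u w uw
  by (simp add: deflated_mult_vec scalar_prod_minus_distrib[of _ n] scalar_prod_mult_mat)

lemma scalar_prod_char_matrix:
  assumes "v \<in> carrier_vec n"
  shows "u \<bullet> (char_matrix A \<mu> *\<^sub>v v) = (lam - \<mu>) * (u \<bullet> v)"
  using assms A u
  by (simp add: char_matrix_mult_vec scalar_prod_minus_distrib[of _ n] scalar_prod_mult_mat
      algebra_simps)

lemma scalar_prod_char_matrix_deflated: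
  assumes "v \<in> carrier_vec n"
  shows "u \<bullet> (char_matrix deflated \<mu> *\<^sub>v v) = - \<mu> * (u \<bullet> v)"
  using assms u
  by (simp add: char_matrix_mult_vec[OF deflated_carrier] mult_mat_vec_carrier[OF deflated_carrier]
      scalar_prod_minus_distrib[of _ n] scalar_prod_deflated)

text \<open>The annihilator of \<open>u\<close> is invariant under the characteristic matrix of
  \<open>A\<close>, so agreement on it passes from one factor to all powers.\<close>

lemma char_matrix_pow_deflated_mult_vec:
  assumes "v \<in> carrier_vec n" "u \<bullet> v = 0"
  shows "char_matrix deflated \<mu> ^\<^sub>m k *\<^sub>v v = char_matrix A \<mu> ^\<^sub>m k *\<^sub>v v"
  using assms
proof (induction k arbitrary: v)
  case 0
  then show ?case using A deflated_carrier by (simp add: char_matrix_def)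
next
  case (Suc k)
  have cA: "char_matrix A \<mu> \<in> carrier_mat n n" "char_matrix deflated \<mu> \<in> carrier_mat n n"
    using A deflated_carrier by auto
  have "char_matrix deflated \<mu> *\<^sub>v v = char_matrix A \<mu> *\<^sub>v v"
    using Suc.prems A w
    unfolding char_matrix_mult_vec[OF A Suc.prems(1)]
      char_matrix_mult_vec[OF deflated_carrier Suc.prems(1)] deflated_mult_vec[OF Suc.prems(1)]
    by (intro eq_vecI) auto
  moreover have "u \<bullet> (char_matrix A \<mu> *\<^sub>v v) = 0"
    using Suc.prems by (simp add: scalar_prod_char_matrix)
  ultimately show ?case
    using Suc.IH[of "char_matrix A \<mu> *\<^sub>v v"] Suc.prems cA
    by (simp only: pow_mat_mult_vec_Suc mult_mat_vec_carrier)
qed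

text \<open>This is the case \<open>\<mu> = 0\<close>, where the characteristic matrix is the matrix
  itself.\<close>

lemma pow_mat_deflated_mult_vec:
  assumes "v \<in> carrier_vec n" "u \<bullet> v = 0"
  shows "deflated ^\<^sub>m k *\<^sub>v v = A ^\<^sub>m k *\<^sub>v v"
proof -
  have "char_matrix C 0 = C" if "C \<in> carrier_mat n n" for C :: "'a mat"
    using that unfolding char_matrix_def by (intro eq_matI) auto
  then show ?thesis
    using char_matrix_pow_deflated_mult_vec[OF assms, of 0 k] A deflated_carrier by simp
qed

text \<open>Applying the characteristic matrix multiplies the pairing with \<open>u\<close> by
  \<open>lam - \<mu>\<close> or by \<open>- \<mu>\<close>. Both factors are nonzero, so
  \<open>u\<close> annihilates either kernel, and there the powers agree.\<close>

lemma mat_kernel_char_matrix_pow_deflated: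
  assumes "\<mu> \<noteq> 0" "\<mu> \<noteq> lam"
  shows "mat_kernel (char_matrix deflated \<mu> ^\<^sub>m k) = mat_kernel (char_matrix A \<mu> ^\<^sub>m k)"
proof -
  have cA: "char_matrix A \<mu> \<in> carrier_mat n n" and cB: "char_matrix deflated \<mu> \<in> carrier_mat n n"
    using A deflated_carrier by auto
  have "u \<bullet> v = 0" if "v \<in> mat_kernel (char_matrix A \<mu> ^\<^sub>m k)" for v
    using mat_kernelD[OF pow_carrier_mat[OF cA] that] assms u
      scalar_prod_pow_mat_mult_vec[OF cA scalar_prod_char_matrix, where v = v and k = k] by auto
  moreover have "u \<bullet> v = 0" if "v \<in> mat_kernel (char_matrix deflated \<mu> ^\<^sub>m k)" for v
    using mat_kernelD[OF pow_carrier_mat[OF cB] that] assms u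
      scalar_prod_pow_mat_mult_vec[OF cB scalar_prod_char_matrix_deflated, where v = v and k = k] by auto
  ultimately show ?thesis
    using char_matrix_pow_deflated_mult_vec[of _ \<mu> k]
    unfolding set_eq_iff mat_kernel[OF pow_carrier_mat[OF cA]] mat_kernel[OF pow_carrier_mat[OF cB]]
      mem_Collect_eq
    by metis
qed

lemma dim_gen_eigenspace_deflated:
  assumes "\<mu> \<noteq> 0" "\<mu> \<noteq> lam"
  shows "dim_gen_eigenspace deflated \<mu> k = dim_gen_eigenspace A \<mu> k"
proof -
  have "dim_col (char_matrix C \<mu> ^\<^sub>m k) = n" if "C \<in> carrier_mat n n" for C :: "'a mat"
    using pow_carrier_mat[OF char_matrix_closed[OF that]] by blast
  then show ?thesis
    unfolding dim_gen_eigenspace_def kernel_dim_def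
    using mat_kernel_char_matrix_pow_deflated[OF assms] A deflated_carrier by simp
qed

text \<open>For a nonzero eigenvalue the eigenvector lies in the range of the deflated matrix, which
  \<open>u\<close> annihilates.\<close>

lemma eigenvector_deflated:
  assumes ev: "eigenvector deflated v \<mu>" and "\<mu> \<noteq> 0"
  shows "u \<bullet> v = 0" "eigenvector A v \<mu>"
proof -
  have v: "v \<in> carrier_vec n" "v \<noteq> 0\<^sub>v n" "deflated *\<^sub>v v = \<mu> \<cdot>\<^sub>v v"
    using ev deflated_carrier unfolding eigenvector_def by auto
  show uv: "u \<bullet> v = 0"
    using scalar_prod_deflated[OF v(1)] v assms(2) u by simp
  have "A *\<^sub>v v = \<mu> \<cdot>\<^sub>v v"
    using pow_mat_deflated_mult_vec[OF v(1) uv, of 1] v A deflated_carrier by simp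
  then show "eigenvector A v \<mu>"
    using v A unfolding eigenvector_def by auto
qed

end

text \<open>On \<open>v\<close> the powers of \<open>A\<close> are those of the deflated matrix, to
  which the semisimple bound applies. The assumption \<open>simple\<close> is the form in which
  geometric simplicity of \<open>lam\<close> enters.\<close>

lemma pow_mat_mult_vec_bound:
  fixes A :: "complex mat"
  assumes "deflation A n lam w u" and r: "0 < r"
    and simple: "\<And>v. eigenvector A v lam \<Longrightarrow> u \<bullet> v \<noteq> 0"
    and le: "\<And>\<mu>. eigenvalue A \<mu> \<Longrightarrow> \<mu> \<noteq> lam \<Longrightarrow> cmod \<mu> \<le> r"
    and eq: "\<And>\<mu>. eigenvalue A \<mu> \<Longrightarrow> cmod \<mu> = r \<Longrightarrow> semisimple_eigenvalue A \<mu>"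
    and v: "v \<in> carrier_vec n" "u \<bullet> v = 0"
  shows "\<exists>c. \<forall>k. \<forall>i<n. cmod ((A ^\<^sub>m k *\<^sub>v v) $ i) \<le> c * r ^ k"
proof -
  interpret deflation A n lam w u by fact
  \<comment> \<open>If a nonzero \<open>lam\<close> were an eigenvalue of the deflated matrix, its
    eigenvector would be one of \<open>A\<close> annihilated by \<open>u\<close>, against
    \<open>simple\<close>.\<close>
  have ev: "eigenvalue A \<mu> \<and> \<mu> \<noteq> lam" if "eigenvalue deflated \<mu>" "\<mu> \<noteq> 0" for \<mu>
    using that eigenvector_deflated simple unfolding eigenvalue_def by blast
  obtain as bs where jnf: "jordan_nf A as" "jordan_nf deflated bs"
    using complex_jordan_nf_exists A deflated_carrier by metis
  have "\<exists>c. \<forall>k. norm_bound (deflated ^\<^sub>m k) (c * r ^ k)"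
  proof (rule pow_mat_bound_semisimple[OF deflated_carrier r])
    show "cmod \<mu> \<le> r" if "eigenvalue deflated \<mu>" for \<mu>
      using that ev le r by (cases "\<mu> = 0") auto
  next
    fix \<mu> assume \<mu>: "eigenvalue deflated \<mu>" "cmod \<mu> = r"
    then have "\<mu> \<noteq> 0" using r by auto
    with \<mu> have "eigenvalue A \<mu>" "\<mu> \<noteq> lam" using ev by auto
    \<comment> \<open>Both multiplicities are dimensions of generalized eigenspaces, and these
      survive the deflation away from \<open>0\<close> and \<open>lam\<close>.\<close>
    then show "semisimple_eigenvalue deflated \<mu>"
      using \<mu> eq[of \<mu>] \<open>\<mu> \<noteq> 0\<close> A deflated_carrier jnf
      unfolding semisimple_eigenvalue_def
      by (simp add: geometric_multiplicity_eq_dim_gen_eigenspace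
          algebraic_multiplicity_eq_dim_gen_eigenspace dim_gen_eigenspace_deflated)
  qed
  then obtain c where c: "\<And>k. norm_bound (deflated ^\<^sub>m k) (c * r ^ k)" by blast
  show ?thesis
  proof (intro exI[of _ "c * (\<Sum>j<n. cmod (v $ j))"] allI impI)
    fix k i assume i: "i < n"
    have B: "deflated ^\<^sub>m k \<in> carrier_mat n n" using deflated_carrier by simp
    have "(A ^\<^sub>m k *\<^sub>v v) $ i = (\<Sum>j<n. (deflated ^\<^sub>m k) $$ (i, j) * v $ j)"
      unfolding pow_mat_deflated_mult_vec[OF v, symmetric]
      by (rule index_mult_mat_vec_sum[OF B v(1) i])
    also have "cmod \<dots> \<le> (\<Sum>j<n. c * r ^ k * cmod (v $ j))"
      using c[of k] carrier_matD[OF B] i unfolding norm_bound_def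
      by (intro sum_norm_le) (auto simp: norm_mult intro!: mult_right_mono)
    also have "\<dots> = c * (\<Sum>j<n. cmod (v $ j)) * r ^ k"
      by (simp add: sum_distrib_left sum_distrib_right ac_simps)
    finally show "cmod ((A ^\<^sub>m k *\<^sub>v v) $ i) \<le> c * (\<Sum>j<n. cmod (v $ j)) * r ^ k" .
  qed
qed

section \<open>Eigenvectors of primitive matrices\<close>

text \<open>Subtracting the largest multiple of \<open>w\<close> that stays below \<open>v\<close> leaves a nonnegative eigenvector
  with a zero entry, which a positive matrix forces to vanish.\<close>

lemma positive_mat_eigenvector_unique:
  fixes P :: "real mat"
  assumes P: "P \<in> carrier_mat n n" and pos: "\<And>i j. i < n \<Longrightarrow> j < n \<Longrightarrow> 0 < P $$ (i, j)"
    and w: "w \<in> carrier_vec n" "\<And>i. i < n \<Longrightarrow> 0 < w $ i" "P *\<^sub>v w = c \<cdot>\<^sub>v w"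
    and v: "v \<in> carrier_vec n" "P *\<^sub>v v = c \<cdot>\<^sub>v v"
  shows "\<exists>d. v = d \<cdot>\<^sub>v w"
proof (cases "n = 0")
  case True
  then show ?thesis using v w by (intro exI[of _ 0] eq_vecI) auto
next
  case False
  define d where "d = Min ((\<lambda>i. v $ i / w $ i) ` {..<n})"
  have "d \<in> (\<lambda>i. v $ i / w $ i) ` {..<n}"
    unfolding d_def using False by (intro Min_in) auto
  then obtain i where i: "i < n" "d = v $ i / w $ i" by auto
  have nonneg: "0 \<le> v $ j - d * w $ j" if "j < n" for j
  proof -
    have "d \<le> v $ j / w $ j" unfolding d_def using that by (intro Min_le) auto
    then show ?thesis using w(2)[OF that] by (simp add: field_simps)
  qed
  \<comment> \<open>At the minimizing index \<open>i\<close> the difference of \<open>v\<close> and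
    \<open>d\<close> times \<open>w\<close> is zero, so row \<open>i\<close> of the eigenvector
    equation is a vanishing sum of nonnegative terms.\<close>
  have "(\<Sum>j<n. P $$ (i, j) * (v $ j - d * w $ j)) = (P *\<^sub>v v) $ i - d * (P *\<^sub>v w) $ i"
    unfolding index_mult_mat_vec_sum[OF P v(1) i(1)] index_mult_mat_vec_sum[OF P w(1) i(1)]
    by (simp add: algebra_simps sum_subtractf sum_distrib_left)
  also have "\<dots> = 0"
    unfolding v(2) w(3) using i v(1) w(1) w(2)[OF i(1)] by simp
  finally have sum0: "(\<Sum>j<n. P $$ (i, j) * (v $ j - d * w $ j)) = 0" .
  have "\<forall>j\<in>{..<n}. P $$ (i, j) * (v $ j - d * w $ j) = 0"
  proof (subst sum_nonneg_eq_0_iff[symmetric])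
    show "0 \<le> P $$ (i, j) * (v $ j - d * w $ j)" if "j \<in> {..<n}" for j
      using that pos[OF i(1), of j] nonneg[of j] by simp
  qed (use sum0 in auto)
  then have "v $ j = d * w $ j" if "j < n" for j
    using that pos[OF i(1) that] by force
  then show ?thesis using v(1) w(1) by (intro exI[of _ d] eq_vecI) auto
qed

text \<open>Eigenvectors of \<open>A\<close> for \<open>c\<close> are eigenvectors of the positive
  matrix \<open>A ^\<^sub>m k\<close> for \<open>c ^ k\<close>.\<close>

lemma eigenvector_unique_of_pow_positive:
  fixes A :: "real mat"
  assumes A: "A \<in> carrier_mat n n" and pos: "\<And>i j. i < n \<Longrightarrow> j < n \<Longrightarrow> 0 < (A ^\<^sub>m k) $$ (i, j)"
    and w: "w \<in> carrier_vec n" "\<And>i. i < n \<Longrightarrow> 0 < w $ i" "A *\<^sub>v w = c \<cdot>\<^sub>v w"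
    and v: "v \<in> carrier_vec n" "A *\<^sub>v v = c \<cdot>\<^sub>v v"
  shows "\<exists>d. v = d \<cdot>\<^sub>v w"
  using positive_mat_eigenvector_unique[OF pow_carrier_mat[OF A] pos w(1,2)
      pow_mat_mult_eigenvector[OF A w(1,3)] v(1) pow_mat_mult_eigenvector[OF A v]]
  by blast

text \<open>Since \<open>A\<close> and \<open>c\<close> are real, the real and imaginary parts of
  \<open>v\<close> satisfy the real equation separately; their two factors are the parts of
  \<open>d\<close>.\<close>

lemma complex_eigenvector_unique_of_pow_positive:
  fixes A :: "real mat"
  assumes A: "A \<in> carrier_mat n n" and pos: "\<And>i j. i < n \<Longrightarrow> j < n \<Longrightarrow> 0 < (A ^\<^sub>m k) $$ (i, j)"
    and w: "w \<in> carrier_vec n" "\<And>i. i < n \<Longrightarrow> 0 < w $ i" "A *\<^sub>v w = c \<cdot>\<^sub>v w"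
    and v: "v \<in> carrier_vec n"
      "map_mat complex_of_real A *\<^sub>v v = complex_of_real c \<cdot>\<^sub>v v"
  shows "\<exists>d. v = d \<cdot>\<^sub>v map_vec complex_of_real w"
proof -
  have cA: "map_mat complex_of_real A \<in> carrier_mat n n" using A by simp
  have eq: "(\<Sum>j<n. complex_of_real (A $$ (i, j)) * v $ j) = complex_of_real c * v $ i"
    if "i < n" for i
    using index_mult_mat_vec_sum[OF cA v(1) that] that v A by simp
  have "A *\<^sub>v map_vec Re v = c \<cdot>\<^sub>v map_vec Re v"
  proof (rule eq_vecI)
    fix i assume "i < dim_vec (c \<cdot>\<^sub>v map_vec Re v)"
    then have i: "i < n" using v by simp
    show "(A *\<^sub>v map_vec Re v) $ i = (c \<cdot>\<^sub>v map_vec Re v) $ i"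
      using arg_cong[OF eq[OF i], of Re] i v
      by (subst index_mult_mat_vec_sum[OF A _ i]) auto
  qed (use A v in auto)
  then obtain a where a: "map_vec Re v = a \<cdot>\<^sub>v w"
    using eigenvector_unique_of_pow_positive[OF A pos w] v by fastforce
  have "A *\<^sub>v map_vec Im v = c \<cdot>\<^sub>v map_vec Im v"
  proof (rule eq_vecI)
    fix i assume "i < dim_vec (c \<cdot>\<^sub>v map_vec Im v)"
    then have i: "i < n" using v by simp
    show "(A *\<^sub>v map_vec Im v) $ i = (c \<cdot>\<^sub>v map_vec Im v) $ i"
      using arg_cong[OF eq[OF i], of Im] i v
      by (subst index_mult_mat_vec_sum[OF A _ i]) auto
  qed (use A v in auto)
  then obtain b where b: "map_vec Im v = b \<cdot>\<^sub>v w"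
    using eigenvector_unique_of_pow_positive[OF A pos w] v by fastforce
  show ?thesis
  proof (intro exI eq_vecI)
    fix i assume "i < dim_vec (Complex a b \<cdot>\<^sub>v map_vec complex_of_real w)"
    then have i: "i < n" using w by simp
    show "v $ i = (Complex a b \<cdot>\<^sub>v map_vec complex_of_real w) $ i"
      using arg_cong[OF a, of "\<lambda>x. x $ i"] arg_cong[OF b, of "\<lambda>x. x $ i"] i v w
      by (simp add: complex_eq_iff)
  qed (use v w in auto)
qed

text \<open>Nonnegativity of \<open>A *\<^sub>v w\<close> gives \<open>0 \<le> c\<close>; positivity
  of \<open>A ^\<^sub>m k *\<^sub>v w\<close> gives \<open>c ^ k \<noteq> 0\<close>, which for
  \<open>k > 0\<close> excludes \<open>c = 0\<close>.\<close>

lemma eigenvalue_positive_of_pow_positive: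
  fixes A :: "real mat"
  assumes A: "A \<in> carrier_mat n n" and nonneg: "\<And>i j. i < n \<Longrightarrow> j < n \<Longrightarrow> 0 \<le> A $$ (i, j)"
    and pos: "\<And>i j. i < n \<Longrightarrow> j < n \<Longrightarrow> 0 < (A ^\<^sub>m k) $$ (i, j)" and "k > 0" "n > 0"
    and w: "w \<in> carrier_vec n" "\<And>i. i < n \<Longrightarrow> 0 < w $ i" "A *\<^sub>v w = c \<cdot>\<^sub>v w"
  shows "0 < c"
proof -
  have "0 \<le> (A *\<^sub>v w) $ 0"
    unfolding index_mult_mat_vec_sum[OF A w(1) \<open>n > 0\<close>]
    using nonneg w(2) \<open>n > 0\<close> by (intro sum_nonneg mult_nonneg_nonneg) (auto intro: less_imp_le)
  then have "0 \<le> c"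
    unfolding w(3) using w(1) w(2)[OF \<open>n > 0\<close>] \<open>n > 0\<close> by (simp add: zero_le_mult_iff)
  have "0 < (A ^\<^sub>m k *\<^sub>v w) $ 0"
    unfolding index_mult_mat_vec_sum[OF pow_carrier_mat[OF A] w(1) \<open>n > 0\<close>]
    using pos w(2) \<open>n > 0\<close> by (intro sum_pos mult_pos_pos) auto
  then have "0 < c ^ k * w $ 0"
    unfolding pow_mat_mult_eigenvector[OF A w(1,3)] using w(1) \<open>n > 0\<close> by simp
  then have "c ^ k \<noteq> 0" by (metis less_irrefl mult_zero_left)
  with \<open>k > 0\<close> have "c \<noteq> 0" by (cases k) auto
  with \<open>0 \<le> c\<close> show ?thesis by simp
qed

section \<open>Paths and words of an automaton\<close>

lemma adjacency_mat_carrier: "adjacency_mat M \<in> carrier_mat (num_states M) (num_states M)"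
  by (simp add: adjacency_mat_def)

text \<open>Transitions are grouped by target; parallel ones contribute equally and are counted by
  the matrix entry.\<close>

lemma sum_transitions_target:
  fixes f :: "nat \<Rightarrow> real"
  assumes "finite_automaton M" "i < num_states M"
  shows "(\<Sum>t | t \<in> transitions M \<and> source t = i. f (target t)) =
    (\<Sum>j<num_states M. adjacency_mat M $$ (i, j) * f j)"
proof -
  let ?T = "{t \<in> transitions M. source t = i}"
  have fin: "finite ?T" "target ` ?T \<subseteq> {..<num_states M}"
    using assms unfolding finite_automaton_def by auto
  have "(\<Sum>t\<in>?T. f (target t)) =
      (\<Sum>j<num_states M. \<Sum>t | t \<in> ?T \<and> target t = j. f (target t))"
    using sum.group[OF fin(1) _ fin(2), of "\<lambda>t. f (target t)"] by simp
  also have "\<dots> = (\<Sum>j<num_states M. adjacency_mat M $$ (i, j) * f j)"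
    using assms(2) by (intro sum.cong) (auto simp: adjacency_mat_def conj_assoc)
  finally show ?thesis .
qed

lemma end_state_simps [simp]:
  "end_state i [] = i"
  "end_state i (t # ts) = end_state (target t) ts"
  by (simp_all add: end_state_def)

text \<open>The start state is a parameter because the recursion on the length strips the first
  transition.\<close>

definition accepted_paths :: "'a automaton \<Rightarrow> nat \<Rightarrow> nat \<Rightarrow> 'a transition list set" where
  "accepted_paths M i l = {ts. path M i ts \<and> length ts = l \<and> end_state i ts \<in> finals M}"

lemma accepted_paths_0: "accepted_paths M i 0 = (if i \<in> finals M then {[]} else {})"
  by (auto simp: accepted_paths_def)

lemma accepted_paths_Suc:
  "accepted_paths M i (Suc l) =
    (\<Union>t\<in>{t \<in> transitions M. source t = i}. (#) t ` accepted_paths M (target t) l)"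
  by (auto simp: accepted_paths_def length_Suc_conv)

lemma finite_accepted_paths:
  assumes "finite_automaton M"
  shows "finite (accepted_paths M i l)"
proof (induction l arbitrary: i)
  case (Suc l)
  then show ?case using assms by (simp add: accepted_paths_Suc finite_automaton_def)
qed (simp add: accepted_paths_0)

lemma indicator_vec_carrier: "indicator_vec n S \<in> carrier_vec n"
  by (simp add: indicator_vec_def)

text \<open>Splitting off the first transition, the counts for length \<open>Suc l\<close> arise
  from those for \<open>l\<close> by applying the adjacency matrix; length zero gives the indicator
  vector.\<close>

lemma card_accepted_paths:
  assumes M: "finite_automaton M" and "i < num_states M"
  shows "real (card (accepted_paths M i l)) =
    (adjacency_mat M ^\<^sub>m l *\<^sub>v indicator_vec (num_states M) (finals M)) $ i"
  using assms(2)
proof (induction l arbitrary: i)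
  case 0
  then show ?case
    by (simp add: accepted_paths_0 adjacency_mat_def indicator_vec_def)
next
  case (Suc l)
  let ?n = "num_states M" and ?A = "adjacency_mat M"
  let ?e = "indicator_vec ?n (finals M)"
  have *: "?A ^\<^sub>m l *\<^sub>v ?e \<in> carrier_vec ?n"
    by (rule mult_mat_vec_carrier[OF pow_carrier_mat[OF adjacency_mat_carrier] indicator_vec_carrier])
  have "card (accepted_paths M i (Suc l)) =
      (\<Sum>t | t \<in> transitions M \<and> source t = i. card ((#) t ` accepted_paths M (target t) l))"
    unfolding accepted_paths_Suc
    using M finite_accepted_paths[OF M] by (intro card_UN_disjoint) (auto simp: finite_automaton_def)
  also have "\<dots> = (\<Sum>t | t \<in> transitions M \<and> source t = i. card (accepted_paths M (target t) l))"
    by (intro sum.cong refl card_image) simp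
  finally have "real (card (accepted_paths M i (Suc l))) =
      (\<Sum>t | t \<in> transitions M \<and> source t = i. real (card (accepted_paths M (target t) l)))"
    by simp
  also have "\<dots> = (\<Sum>j<?n. ?A $$ (i, j) * real (card (accepted_paths M j l)))"
    by (rule sum_transitions_target[OF M Suc.prems])
  also have "\<dots> = (\<Sum>j<?n. ?A $$ (i, j) * (?A ^\<^sub>m l *\<^sub>v ?e) $ j)"
    using Suc.IH by simp
  also have "\<dots> = (?A *\<^sub>v (?A ^\<^sub>m l *\<^sub>v ?e)) $ i"
    by (rule index_mult_mat_vec_sum[OF adjacency_mat_carrier * Suc.prems, symmetric])
  finally show ?case
    by (simp only: pow_mat_mult_vec_Suc_left[OF adjacency_mat_carrier indicator_vec_carrier])
qed

lemma path_unique: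
  assumes "deterministic M" "path M i ts" "path M i ts'" "map letter ts = map letter ts'"
  shows "ts = ts'"
  using assms(2-)
proof (induction ts arbitrary: i ts')
  case (Cons t ts)
  then obtain t' us where ts': "ts' = t' # us" by (cases ts') auto
  have "t = t'"
    using Cons.prems assms(1) unfolding ts' deterministic_def by auto
  with Cons show ?case unfolding ts' by auto
qed simp

lemma run_map_letter:
  assumes "deterministic M" "path M (initial M) ts"
  shows "run M (map letter ts) = ts"
  unfolding run_def using assms path_unique by (intro the_equality) blast+

lemma language_of_length_eq:
  "language_of_length M l = map letter ` accepted_paths M (initial M) l"
  by (auto simp: language_of_length_def language_def accepted_paths_def)

text \<open>By determinism, reading off labels is injective on accepted paths, so counting words is
  counting paths.\<close>

lemma card_language_of_length:
  assumes "deterministic M"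
  shows "card (language_of_length M l) = card (accepted_paths M (initial M) l)"
  unfolding language_of_length_eq
  by (rule card_image, rule inj_onI) (auto simp: accepted_paths_def intro: path_unique[OF assms])

lemma end_state_less:
  assumes "finite_automaton M" "path M i ts" "i < num_states M"
  shows "end_state i ts < num_states M"
  using assms(2,3)
proof (induction ts arbitrary: i)
  case (Cons t ts)
  then show ?case using assms(1) by (auto simp: finite_automaton_def)
qed simp

lemma prod_transition_weight:
  assumes M: "finite_automaton M" and path: "path M i ts" "i < num_states M"
    and w: "\<And>j. j < num_states M \<Longrightarrow> 0 < w $ j" and "lam \<noteq> 0"
  shows "(\<Prod>t\<leftarrow>ts. transition_weight lam w t) = w $ end_state i ts / (w $ i * lam ^ length ts)"
  using path
proof (induction ts arbitrary: i)
  case Nil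
  then show ?case using w[of i] by simp
next
  case (Cons t ts)
  then have t: "source t = i" "target t < num_states M" "path M (target t) ts"
    using M by (auto simp: finite_automaton_def)
  show ?case
    using Cons.IH[OF t(3,2)] t(1) w[OF t(2)] w[OF Cons.prems(2)] \<open>lam \<noteq> 0\<close>
    by (simp add: transition_weight_def field_simps)
qed

section \<open>The transition matrix of the Markov chain\<close>

lemma chain_mat_carrier: "chain_mat M lam w \<in> carrier_mat (num_states M) (num_states M)"
  by (simp add: chain_mat_def)

text \<open>All transitions from \<open>i\<close> to \<open>j\<close> have the same weight. For
  positive \<open>w\<close> and \<open>lam\<close>, the chain matrix is therefore
  \<open>A / lam\<close> conjugated by the diagonal matrix of \<open>w\<close>.\<close>

lemma chain_mat_index:
  assumes "i < num_states M" "j < num_states M"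
  shows "chain_mat M lam w $$ (i, j) = adjacency_mat M $$ (i, j) * w $ j / (w $ i * lam)"
  using assms by (simp add: chain_mat_def adjacency_mat_def transition_weight_def)

theorem lemma4p1:
  fixes M :: "'a automaton" and n :: nat and A :: "real mat" and A\<^sub>c :: "complex mat"
    and lam \<xi> :: real and w u :: "real vec"
  defines "n \<equiv> num_states M"
    and "A \<equiv> adjacency_mat M"
    and "A\<^sub>c \<equiv> map_mat complex_of_real A"
  assumes "finite_automaton M" and "deterministic M"
    and "initial M = 0" and "finals M \<noteq> {}"
    and "primitive_mat A"
    and "dominant_eigenvalue A\<^sub>c (complex_of_real lam)"
    and "0 < \<xi>" and "\<xi> < 1"
    and "\<And>\<mu>. eigenvalue A\<^sub>c \<mu> \<Longrightarrow> \<mu> \<noteq> complex_of_real lam \<Longrightarrow> cmod \<mu> \<le> \<xi> * lam"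
    and "\<And>\<mu>. eigenvalue A\<^sub>c \<mu> \<Longrightarrow> cmod \<mu> = \<xi> * lam \<Longrightarrow> semisimple_eigenvalue A\<^sub>c \<mu>"
    and "eigenvector A w lam" and "positive_vec w" and "w $ 0 = 1"
    and "left_eigenvector A u lam" and "positive_vec u" and "u \<bullet> w = 1"
  shows "(\<forall>i<n. (\<Sum>t | t \<in> transitions M \<and> source t = i. transition_weight lam w t) = 1) \<and>
    (\<exists>C. \<forall>l. \<forall>x\<in>language_of_length M l. \<exists>\<epsilon>.
       word_weight M lam w u x = 1 / real (card (language_of_length M l)) * (1 + \<epsilon>) \<and>
       \<bar>\<epsilon>\<bar> \<le> C * \<xi> ^ l) \<and>
    stochastic_mat (chain_mat M lam w) \<and>
    stationary_distribution (chain_mat M lam w) (vec n (\<lambda>i. u $ i * w $ i)) \<and>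
    (\<forall>v. stationary_distribution (chain_mat M lam w) v \<longrightarrow> v = vec n (\<lambda>i. u $ i * w $ i))"
proof -

  \<comment> \<open>Eigenvector equations in coordinates\<close>
  have M: "finite_automaton M" and det: "deterministic M" by fact+
  have init: "initial M < n" and fin: "finals M \<subseteq> {..<n}"
    using M unfolding finite_automaton_def n_def by auto
  then have n0: "0 < n" by simp
  have A: "A \<in> carrier_mat n n" unfolding A_def n_def by (rule adjacency_mat_carrier)
  obtain k where k: "0 < k" and pos: "\<And>i j. i < n \<Longrightarrow> j < n \<Longrightarrow> 0 < (A ^\<^sub>m k) $$ (i, j)"
    and nonneg: "\<And>i j. i < n \<Longrightarrow> j < n \<Longrightarrow> 0 \<le> A $$ (i, j)"
    using \<open>primitive_mat A\<close> A unfolding primitive_mat_def by auto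
  have w: "w \<in> carrier_vec n" "A *\<^sub>v w = lam \<cdot>\<^sub>v w"
    using \<open>eigenvector A w lam\<close> A unfolding eigenvector_def by auto
  then have w_pos: "0 < w $ i" if "i < n" for i
    using that \<open>positive_vec w\<close> unfolding positive_vec_def by auto
  have u: "u \<in> carrier_vec n" "transpose_mat A *\<^sub>v u = lam \<cdot>\<^sub>v u"
    using \<open>left_eigenvector A u lam\<close> A unfolding left_eigenvector_def eigenvector_def by auto
  then have u_pos: "0 < u $ i" if "i < n" for i
    using that \<open>positive_vec u\<close> unfolding positive_vec_def by auto
  have AT: "transpose_mat A \<in> carrier_mat n n" using A by simp
  have lam: "0 < lam"
    by (rule eigenvalue_positive_of_pow_positive[OF A nonneg pos k n0 w(1) w_pos w(2)])
  have row_sum: "(\<Sum>j<n. A $$ (i, j) * w $ j) = lam * w $ i" if "i < n" for i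
    using index_mult_mat_vec_sum[OF A w(1) that] w that by simp
  have col_sum: "(\<Sum>i<n. A $$ (i, j) * u $ i) = lam * u $ j" if "j < n" for j
    using index_mult_mat_vec_sum[OF AT u(1) that] u that A by simp

  let ?P = "chain_mat M lam w"
  let ?uw = "vec n (\<lambda>i. u $ i * w $ i)"
  have P: "?P \<in> carrier_mat n n" unfolding n_def by (rule chain_mat_carrier)
  have P_index: "?P $$ (i, j) = A $$ (i, j) * w $ j / (w $ i * lam)" if "i < n" "j < n" for i j
    using that chain_mat_index unfolding n_def A_def by blast
  have PT: "transpose_mat ?P \<in> carrier_mat n n" using P by simp

  \<comment> \<open>Normalization of the transition weights\<close>
  have "(\<Sum>t | t \<in> transitions M \<and> source t = i. transition_weight lam w t) = 1"
    if "i < n" for i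
  proof -
    have "(\<Sum>t | t \<in> transitions M \<and> source t = i. transition_weight lam w t) =
        (\<Sum>t | t \<in> transitions M \<and> source t = i. w $ target t / (w $ i * lam))"
      by (intro sum.cong) (auto simp: transition_weight_def)
    also have "\<dots> = (\<Sum>j<n. A $$ (i, j) * (w $ j / (w $ i * lam)))"
      using sum_transitions_target[OF M, of i "\<lambda>j. w $ j / (w $ i * lam)"] that
      unfolding n_def A_def by simp
    also have "\<dots> = (\<Sum>j<n. A $$ (i, j) * w $ j) / (w $ i * lam)"
      by (simp add: sum_divide_distrib)
    also have "\<dots> = 1" using row_sum[OF that] w_pos[OF that] lam by simp
    finally show ?thesis .
  qed

  \<comment> \<open>Asymptotics of the word weights\<close>
  moreover have "\<exists>C. \<forall>l. \<forall>x\<in>language_of_length M l. \<exists>\<epsilon>.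
       word_weight M lam w u x = 1 / real (card (language_of_length M l)) * (1 + \<epsilon>) \<and>
       \<bar>\<epsilon>\<bar> \<le> C * \<xi> ^ l"
  proof -
    let ?e = "indicator_vec n (finals M)"
    define \<alpha> where "\<alpha> = u \<bullet> ?e"
    have e: "?e \<in> carrier_vec n" by (rule indicator_vec_carrier)
    have "\<alpha> = (\<Sum>i<n. if i \<in> finals M then u $ i else 0)"
      unfolding \<alpha>_def scalar_prod_sum[OF e] by (intro sum.cong) (auto simp: indicator_vec_def)
    also obtain f where f: "f \<in> finals M" using \<open>finals M \<noteq> {}\<close> by blast
    then have "(\<Sum>i<n. if i \<in> finals M then u $ i else 0) > 0"
      using fin u_pos by (intro sum_pos2[of _ f]) (auto intro: less_imp_le)
    finally have \<alpha>: "0 < \<alpha>" .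

    let ?v = "?e - \<alpha> \<cdot>\<^sub>v w"
    let ?c = "map_vec complex_of_real"
    have v: "?v \<in> carrier_vec n" using w e by auto
    have uv: "u \<bullet> ?v = 0"
      using u(1) w(1) e \<open>u \<bullet> w = 1\<close> by (simp add: scalar_prod_minus_distrib[of _ n] \<alpha>_def)
    have of_real_scalar_prod: "?c x \<bullet> ?c y = complex_of_real (x \<bullet> y)"
      if "y \<in> carrier_vec n" "x \<in> carrier_vec n" for x y
      using that by (simp add: scalar_prod_def)
    have Ac: "A\<^sub>c \<in> carrier_mat n n" unfolding A\<^sub>c_def using A by simp
    \<comment> \<open>Deflation is carried out over the complex numbers, where every matrix has a
      Jordan normal form.\<close>
    have defl: "deflation A\<^sub>c n (complex_of_real lam) (?c w) (?c u)"
    proof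
      have "transpose_mat A\<^sub>c = map_mat complex_of_real (transpose_mat A)"
        unfolding A\<^sub>c_def by (intro eq_matI) auto
      then have "transpose_mat A\<^sub>c *\<^sub>v ?c u = ?c (transpose_mat A *\<^sub>v u)"
        by (simp only: of_real_hom.mult_mat_vec_hom[OF AT u(1)])
      then show "transpose_mat A\<^sub>c *\<^sub>v ?c u = complex_of_real lam \<cdot>\<^sub>v ?c u"
        by (simp only: u(2) of_real_hom.vec_hom_smult)
    qed (use w u Ac of_real_scalar_prod \<open>u \<bullet> w = 1\<close> in auto)
    \<comment> \<open>An eigenvector for \<open>lam\<close> is a multiple of \<open>w\<close>, and
      \<open>u \<bullet> w = 1\<close>; if \<open>u\<close> annihilated it, the factor would be
      zero.\<close>
    have not_orth: "?c u \<bullet> x \<noteq> 0" if "eigenvector A\<^sub>c x (complex_of_real lam)" for x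
    proof
      assume ux: "?c u \<bullet> x = 0"
      have x: "x \<in> carrier_vec n" "x \<noteq> 0\<^sub>v n" "A\<^sub>c *\<^sub>v x = complex_of_real lam \<cdot>\<^sub>v x"
        using that Ac unfolding eigenvector_def by auto
      obtain d where d: "x = d \<cdot>\<^sub>v ?c w"
        using complex_eigenvector_unique_of_pow_positive[OF A pos w(1) w_pos w(2) x(1)] x(3)
        unfolding A\<^sub>c_def by blast
      have "d = 0"
        using ux u(1) w(1) \<open>u \<bullet> w = 1\<close> by (simp add: d of_real_scalar_prod)
      then show False using x(2) w(1) by (auto simp: d)
    qed
    have "\<exists>c. \<forall>l. \<forall>i<n. cmod ((A\<^sub>c ^\<^sub>m l *\<^sub>v ?c ?v) $ i) \<le> c * (\<xi> * lam) ^ l"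
    proof (rule pow_mat_mult_vec_bound[OF defl _ not_orth assms(12,13)])
      show "0 < \<xi> * lam" using \<open>0 < \<xi>\<close> lam by simp
      show "?c ?v \<in> carrier_vec n" using v by simp
      show "?c u \<bullet> ?c ?v = 0" unfolding of_real_scalar_prod[OF v u(1)] uv by simp
    qed
    then obtain c where
      c: "\<And>l i. i < n \<Longrightarrow> cmod ((A\<^sub>c ^\<^sub>m l *\<^sub>v ?c ?v) $ i) \<le> c * (\<xi> * lam) ^ l"
      by blast
    \<comment> \<open>The product with a real vector is real, so the complex bound is a bound on
      absolute values.\<close>
    have bound: "\<bar>(A ^\<^sub>m l *\<^sub>v ?v) $ i\<bar> \<le> c * (\<xi> * lam) ^ l" if "i < n" for l i
    proof -
      have "A\<^sub>c ^\<^sub>m l *\<^sub>v ?c ?v = ?c (A ^\<^sub>m l *\<^sub>v ?v)"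
        unfolding A\<^sub>c_def of_real_hom.mat_hom_pow[OF A, symmetric]
        by (rule of_real_hom.mult_mat_vec_hom[OF pow_carrier_mat[OF A] v, symmetric])
      then show ?thesis
        using c[OF that, of l] that carrier_vecD[OF mult_mat_vec_carrier[OF pow_carrier_mat[OF A] v]]
        by (simp del: dim_mult_mat_vec index_mult_mat_vec)
    qed
    show ?thesis
    \<comment> \<open>The relative error is a remainder of size at most
      \<open>c * (\<xi> * lam) ^ l\<close> over the main term \<open>\<alpha> * lam ^ l\<close>; the
      quotient \<open>c / \<alpha>\<close> depends on neither \<open>l\<close> nor
      \<open>x\<close>.\<close>
    proof (rule exI[of _ "c / \<alpha>"], intro allI ballI)
      fix l x assume x: "x \<in> language_of_length M l"
      then obtain ts where ts: "ts \<in> accepted_paths M (initial M) l" "x = map letter ts"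
        unfolding language_of_length_eq by auto
      then have path: "path M (initial M) ts" "length ts = l" by (auto simp: accepted_paths_def)
      have run: "run M x = ts" using run_map_letter[OF det path(1)] ts by simp
      define s where "s = end_state (initial M) ts"
      have s: "s < n" unfolding s_def n_def using end_state_less[OF M path(1)] init n_def by simp
      have "word_weight M lam w u x = 1 / (w $ s * \<alpha>) * (w $ s / (w $ 0 * lam ^ l))"
        using prod_transition_weight[OF M path(1), of w lam] init w_pos lam path(2) \<open>initial M = 0\<close>
        unfolding word_weight_def run s_def[symmetric] \<alpha>_def n_def by simp
      \<comment> \<open>The end state has cancelled, so all words of length \<open>l\<close> have
        the same weight.\<close>
      then have weight: "word_weight M lam w u x = 1 / (\<alpha> * lam ^ l)"
        using w_pos[OF s] \<open>w $ 0 = 1\<close> by simp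
      define N where "N = real (card (language_of_length M l))"
      have "A ^\<^sub>m l *\<^sub>v ?e = A ^\<^sub>m l *\<^sub>v (\<alpha> \<cdot>\<^sub>v w + ?v)"
        using w(1) e by (intro arg_cong[of _ _ "\<lambda>x. A ^\<^sub>m l *\<^sub>v x"] eq_vecI) auto
      also have "\<dots> = \<alpha> \<cdot>\<^sub>v (lam ^ l \<cdot>\<^sub>v w) + A ^\<^sub>m l *\<^sub>v ?v"
        using mult_add_distrib_mat_vec[OF pow_carrier_mat[OF A, of l] _ v, of "\<alpha> \<cdot>\<^sub>v w"] w(1)
          mult_mat_vec[OF pow_carrier_mat[OF A] w(1)] pow_mat_mult_eigenvector[OF A w] by simp
      finally have Ae: "A ^\<^sub>m l *\<^sub>v ?e = \<alpha> \<cdot>\<^sub>v (lam ^ l \<cdot>\<^sub>v w) + A ^\<^sub>m l *\<^sub>v ?v" .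
      have "N = (A ^\<^sub>m l *\<^sub>v ?e) $ 0"
        unfolding N_def card_language_of_length[OF det]
        using card_accepted_paths[OF M, of 0 l] init \<open>initial M = 0\<close> unfolding A_def n_def by simp
      also have "\<dots> = \<alpha> * lam ^ l + (A ^\<^sub>m l *\<^sub>v ?v) $ 0"
        unfolding Ae using w(1) n0 \<open>w $ 0 = 1\<close>
          carrier_vecD[OF mult_mat_vec_carrier[OF pow_carrier_mat[OF A] v]]
        by (simp del: dim_mult_mat_vec index_mult_mat_vec)
      finally have N: "N = \<alpha> * lam ^ l + (A ^\<^sub>m l *\<^sub>v ?v) $ 0" .
      have "finite (language_of_length M l)"
        unfolding language_of_length_eq using finite_accepted_paths[OF M] by blast
      \<comment> \<open>The word \<open>x\<close> itself witnesses that there are words of this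
        length, so \<open>1 / N\<close> is a genuine quotient.\<close>
      then have N0: "N > 0" unfolding N_def using x card_gt_0_iff by fastforce
      show "\<exists>\<epsilon>. word_weight M lam w u x = 1 / real (card (language_of_length M l)) * (1 + \<epsilon>) \<and>
          \<bar>\<epsilon>\<bar> \<le> c / \<alpha> * \<xi> ^ l"
      \<comment> \<open>The weight is \<open>1 / N\<close> times
        \<open>N / (\<alpha> * lam ^ l)\<close>, and the last factor is one plus this
        witness.\<close>
      proof (intro exI[of _ "(A ^\<^sub>m l *\<^sub>v ?v) $ 0 / (\<alpha> * lam ^ l)"] conjI)
        have "1 + (A ^\<^sub>m l *\<^sub>v ?v) $ 0 / (\<alpha> * lam ^ l) = N / (\<alpha> * lam ^ l)"
          unfolding N using \<alpha> lam by (simp add: add_divide_distrib)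
        then show "word_weight M lam w u x = 1 / real (card (language_of_length M l)) *
            (1 + (A ^\<^sub>m l *\<^sub>v ?v) $ 0 / (\<alpha> * lam ^ l))"
          unfolding weight N_def[symmetric] using N0 by simp
        have "\<bar>(A ^\<^sub>m l *\<^sub>v ?v) $ 0 / (\<alpha> * lam ^ l)\<bar> = \<bar>(A ^\<^sub>m l *\<^sub>v ?v) $ 0\<bar> / (\<alpha> * lam ^ l)"
          using \<alpha> lam by (simp only: abs_divide abs_mult power_abs abs_of_pos)
        also have "\<dots> \<le> c * (\<xi> * lam) ^ l / (\<alpha> * lam ^ l)"
          using bound[OF n0, of l] \<alpha> lam by (intro divide_right_mono) auto
        also have "\<dots> = c / \<alpha> * \<xi> ^ l" using \<alpha> lam by (simp add: power_mult_distrib)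
        finally show "\<bar>(A ^\<^sub>m l *\<^sub>v ?v) $ 0 / (\<alpha> * lam ^ l)\<bar> \<le> c / \<alpha> * \<xi> ^ l" .
      qed
    qed
  qed

  \<comment> \<open>Stochasticity of the chain matrix\<close>
  moreover have "stochastic_mat ?P"
  proof -
    have "distribution_vec (row ?P i)" if i: "i < n" for i
    proof -
      have "0 \<le> ?P $$ (i, j)" if "j < n" for j
        unfolding P_index[OF i that] using nonneg[OF i that] w_pos[OF i] w_pos[OF that] lam by simp
      moreover have "(\<Sum>j<n. ?P $$ (i, j)) = (\<Sum>j<n. A $$ (i, j) * w $ j) / (w $ i * lam)"
        using i by (simp add: P_index sum_divide_distrib)
      then have "(\<Sum>j<n. ?P $$ (i, j)) = 1"
        using row_sum[OF i] w_pos[OF i] lam by simp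
      ultimately show ?thesis using P i unfolding distribution_vec_def by simp
    qed
    then show ?thesis using P unfolding stochastic_mat_def by simp
  qed

  \<comment> \<open>Stationarity of the product distribution\<close>
  moreover have "stationary_distribution ?P ?uw"
  proof -
    have "transpose_mat ?P *\<^sub>v ?uw = ?uw"
    proof (rule eq_vecI)
      fix j assume "j < dim_vec ?uw"
      then have j: "j < n" by simp
      have "(transpose_mat ?P *\<^sub>v ?uw) $ j = (\<Sum>i<n. ?P $$ (i, j) * (u $ i * w $ i))"
        using P j by (subst index_mult_mat_vec_sum[OF PT _ j]) auto
      \<comment> \<open>The factor \<open>w $ i\<close> cancels the denominator of the transition
        probability, leaving the left eigenvector equation for \<open>u\<close>.\<close>
      also have "\<dots> = (\<Sum>i<n. A $$ (i, j) * u $ i) * w $ j / lam"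
        unfolding sum_distrib_right sum_divide_distrib
        using j w_pos lam by (intro sum.cong) (auto simp: P_index field_simps dest!: less_imp_neq[OF w_pos])
      also have "\<dots> = ?uw $ j" using col_sum[OF j] lam j by simp
      finally show "(transpose_mat ?P *\<^sub>v ?uw) $ j = ?uw $ j" .
    qed (use P in simp)
    moreover have "distribution_vec ?uw"
      using \<open>u \<bullet> w = 1\<close> u_pos w_pos unfolding distribution_vec_def scalar_prod_sum[OF w(1)]
      by (auto intro!: mult_nonneg_nonneg less_imp_le)
    ultimately show ?thesis using P unfolding stationary_distribution_def by simp
  qed

  \<comment> \<open>Uniqueness of the stationary distribution\<close>
  moreover have "v = ?uw" if "stationary_distribution ?P v" for v
  proof -
    have v: "v \<in> carrier_vec n" "(\<Sum>i<n. v $ i) = 1" "transpose_mat ?P *\<^sub>v v = v"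
      using that P unfolding stationary_distribution_def distribution_vec_def by auto
    let ?q = "vec n (\<lambda>i. v $ i / w $ i)"
    have "transpose_mat A *\<^sub>v ?q = lam \<cdot>\<^sub>v ?q"
    proof (rule eq_vecI)
      fix j assume "j < dim_vec (lam \<cdot>\<^sub>v ?q)"
      then have j: "j < n" by simp
      have "v $ j = (\<Sum>i<n. ?P $$ (i, j) * v $ i)"
        using index_mult_mat_vec_sum[OF PT v(1) j] v(3) P j by simp
      also have "\<dots> = (\<Sum>i<n. A $$ (i, j) * (v $ i / w $ i)) * w $ j / lam"
        unfolding sum_distrib_right sum_divide_distrib
        using j by (intro sum.cong) (auto simp: P_index)
      finally have "(\<Sum>i<n. A $$ (i, j) * (v $ i / w $ i)) = lam * (v $ j / w $ j)"
        using w_pos[OF j] lam by (simp add: field_simps)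
      then show "(transpose_mat A *\<^sub>v ?q) $ j = (lam \<cdot>\<^sub>v ?q) $ j"
        using A j by (subst index_mult_mat_vec_sum[OF AT _ j]) auto
    qed (use A in simp)
    moreover have "0 < (transpose_mat A ^\<^sub>m k) $$ (i, j)" if "i < n" "j < n" for i j
      unfolding transpose_pow_mat[OF A] using that pos A by simp
    ultimately obtain d where d: "?q = d \<cdot>\<^sub>v u"
      using eigenvector_unique_of_pow_positive[OF AT _ u(1) u_pos u(2), of k ?q] by auto
    have vi: "v $ i = d * (u $ i * w $ i)" if "i < n" for i
      using arg_cong[OF d, of "\<lambda>x. x $ i"] that u(1) w_pos[OF that] by (simp add: field_simps)
    \<comment> \<open>Both vectors have total mass one, which fixes the factor
      \<open>d\<close>.\<close>
    have "d * (\<Sum>i<n. u $ i * w $ i) = 1"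
      using v(2) by (simp add: vi sum_distrib_left)
    then have "d = 1" using \<open>u \<bullet> w = 1\<close> unfolding scalar_prod_sum[OF w(1)] by simp
    then show ?thesis using v(1) vi by (intro eq_vecI) auto
  qed
  ultimately show ?thesis by blast
qed

end
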